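(* Let $n>1$ and $s>1$ be integers and let $k$ be a formally real field. Then $p_{2s}(k[x_1,\dots,x_n])=\infty$.
   Context: For a commutative ring $A$ with identity and a positive integer $m$, the $m$-th Pythagoras number $p_m(A)$ is the least positive integer $\ell$ such that every element of $A$ that is a sum of $m$-th powers of elements of $A$ can be written as a sum of at most $\ell$ $m$-th powers of elements of $A$; if no such $\ell$ exists, $p_m(A)=\infty$. A field is formally real if $-1$ is not a sum of squares in it. *)

theory Defs
  imports Main "HOL-Library.Poly_Mapping" "HOL-Library.Extended_Nat" "HOL-Library.Cardinality"
begin

(* The polynomial ring k[x_i : i in 'n] is modelled by the type ('n \<Rightarrow>\<^sub>0 nat) \<Rightarrow>\<^sub>0 'k
  (finitely supported coefficient functions on monomials = exponent vectors), whose
  library multiplication is the convolution product. *)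

definition sum_of_mth_powers :: "nat \<Rightarrow> 'a::comm_ring_1 \<Rightarrow> bool" where
  "sum_of_mth_powers m x \<longleftrightarrow> (\<exists>ys. x = sum_list (map (\<lambda>y. y ^ m) ys))"

definition sum_of_at_most_mth_powers :: "nat \<Rightarrow> nat \<Rightarrow> 'a::comm_ring_1 \<Rightarrow> bool" where
  "sum_of_at_most_mth_powers m l x \<longleftrightarrow>
     (\<exists>ys. length ys \<le> l \<and> x = sum_list (map (\<lambda>y. y ^ m) ys))"

definition pythagoras_bound :: "'a::comm_ring_1 itself \<Rightarrow> nat \<Rightarrow> nat \<Rightarrow> bool" where
  "pythagoras_bound _ m l \<longleftrightarrow> 0 < l \<and>
     (\<forall>x::'a. sum_of_mth_powers m x \<longrightarrow> sum_of_at_most_mth_powers m l x)"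

definition pythagoras_number :: "'a::comm_ring_1 itself \<Rightarrow> nat \<Rightarrow> enat" where
  "pythagoras_number T m =
     (if \<exists>l. pythagoras_bound T m l then enat (LEAST l. pythagoras_bound T m l) else \<infinity>)"

definition formally_real :: "'a::field itself \<Rightarrow> bool" where
  "formally_real _ \<longleftrightarrow> \<not> sum_of_mth_powers 2 (- 1 :: 'a)"

end

theory Submission
  imports Defs "HOL-Computational_Algebra.Polynomial"
begin

text \<open>
  Sums of \<open>2s\<close>-th powers of polynomials in \<open>X\<close> and \<open>Y\<close> are made rigid by prescribing zeros. Among
  the polynomials of total degree at most \<open>d\<close>, those vanishing on a triangular array of nodes minus
  some points of its hypotenuse are spanned by products \<open>g\<^sub>k\<close> of lines, one for each omitted point.
  Over a formally real field, if \<open>\<Sum> h\<^sub>j\<^sup>2\<^sup>s = \<Sum> g\<^sub>k\<^sup>2\<^sup>s\<close>, then every \<open>h\<^sub>j\<close> has degree at most \<open>d\<close>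
  and vanishes wherever all \<open>g\<^sub>k\<close> do, so \<open>h\<^sub>j = \<Sum> t\<^sub>j\<^sub>k g\<^sub>k\<close> with constants \<open>t\<^sub>j\<^sub>k\<close>.

  The top forms of the \<open>g\<^sub>k\<close> are univariate polynomials \<open>q\<^sub>k\<close>, and the omitted points can be chosen so
  that the degrees of the \<open>q\<^sub>k\<close> grow by factors larger than \<open>2s\<close>. Write \<open>\<Sum> t\<^sub>j\<^sub>k q\<^sub>k = t\<^sub>j q + w\<^sub>j\<close> with
  \<open>q\<close> the \<open>q\<^sub>k\<close> of largest degree. Comparing expansions in base \<open>q\<close>, the digit at \<open>q\<^sup>2\<^sup>s\<^sup>-\<^sup>2\<close> gives
  \<open>\<Sum> t\<^sub>j\<^sup>2\<^sup>s\<^sup>-\<^sup>2 w\<^sub>j\<^sup>2 = 0\<close>; as \<open>s > 1\<close>, this forces \<open>t\<^sub>j w\<^sub>j = 0\<close>. Hence some \<open>h\<^sub>j\<close> only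
  contributes to the top power \<open>q\<^sup>2\<^sup>s\<close>, and by induction there are at least as many \<open>h\<^sub>j\<close> as \<open>g\<^sub>k\<close>.
\<close>

section \<open>Rings in which sums of squares are anisotropic\<close>

text \<open>Stated for rings, not only fields, because it passes from k to k[y] and is applied to
  the coefficients of polynomials over either.\<close>

definition sum_squares_anisotropic :: "'a::comm_ring_1 itself \<Rightarrow> bool" where
  "sum_squares_anisotropic _ \<longleftrightarrow>
     (\<forall>(J::nat set) u::nat \<Rightarrow> 'a. finite J \<longrightarrow> (\<Sum>j\<in>J. u j ^ 2) = 0 \<longrightarrow> (\<forall>j\<in>J. u j = 0))"

lemma sum_squares_anisotropicD:
  fixes u :: "nat \<Rightarrow> 'a::comm_ring_1"
  assumes "sum_squares_anisotropic TYPE('a)" "finite J" "(\<Sum>j\<in>J. u j ^ 2) = 0" "j \<in> J"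
  shows "u j = 0"
  using assms unfolding sum_squares_anisotropic_def by blast

lemma sum_even_powers_eq_0D:
  fixes u :: "nat \<Rightarrow> 'a::idom"
  assumes "sum_squares_anisotropic TYPE('a)" "finite J" "(\<Sum>j\<in>J. u j ^ (2 * s)) = 0" "j \<in> J"
  shows "u j = 0"
proof -
  have "(\<Sum>j\<in>J. (u j ^ s) ^ 2) = 0"
    using assms(3) by (simp add: power_mult [symmetric] mult.commute)
  then have "u j ^ s = 0"
    using sum_squares_anisotropicD[of J "\<lambda>j. u j ^ s" j] assms by blast
  then show ?thesis by simp
qed

lemma formally_real_imp_anisotropic:
  assumes "formally_real TYPE('k::field)"
  shows "sum_squares_anisotropic TYPE('k)"
  unfolding sum_squares_anisotropic_def
proof (intro allI impI ballI, rule ccontr)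
  fix J :: "nat set" and u :: "nat \<Rightarrow> 'k" and j
  assume J: "finite J" and sum0: "(\<Sum>j\<in>J. u j ^ 2) = 0" and j: "j \<in> J" and nz: "u j \<noteq> 0"
  obtain js where js: "set js = J - {j}" "distinct js"
    using J finite_distinct_list[of "J - {j}"] by auto
  have "u j ^ 2 + (\<Sum>i\<in>J - {j}. u i ^ 2) = 0"
    using sum0 J j by (simp add: sum.remove)
  then have "(\<Sum>i\<in>J - {j}. u i ^ 2) = - (u j ^ 2)"
    by (simp add: eq_neg_iff_add_eq_0 add.commute)
  then have "(\<Sum>i\<in>J - {j}. (u i / u j) ^ 2) = - 1"
    using nz by (simp add: power_divide sum_divide_distrib [symmetric])
  moreover have "(\<Sum>i\<in>J - {j}. (u i / u j) ^ 2)
      = sum_list (map (\<lambda>y. y ^ 2) (map (\<lambda>i. u i / u j) js))"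
    using js by (simp add: sum_list_distinct_conv_sum_set o_def)
  ultimately have "sum_of_mth_powers 2 (- 1 :: 'k)"
    unfolding sum_of_mth_powers_def by metis
  then show False
    using assms by (simp add: formally_real_def)
qed

text \<open>\<open>of_nat n\<close> is a sum of \<open>n\<close> squares of 1, so the characteristic
  is zero: integer nodes stay distinct and binomial coefficients do not vanish.\<close>

lemma anisotropic_of_nat_eq_0D:
  assumes "sum_squares_anisotropic TYPE('a::comm_ring_1)" and "of_nat n = (0::'a)"
  shows "n = 0"
proof (rule ccontr)
  assume "n \<noteq> 0"
  moreover have "(\<Sum>j<n. (1::'a) ^ 2) = 0"
    using assms(2) by simp
  ultimately show False
    using sum_squares_anisotropicD[OF assms(1), of "{..<n}" "\<lambda>_. 1" 0] by simp
qed

lemma anisotropic_of_nat_eq_iff: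
  assumes "sum_squares_anisotropic TYPE('a::comm_ring_1)"
  shows "of_nat m = (of_nat n :: 'a) \<longleftrightarrow> m = n"
proof (induction m n rule: linorder_wlog)
  case (le m n)
  have "of_nat m = (of_nat n :: 'a) \<Longrightarrow> of_nat (n - m) = (0::'a)"
    using le by (simp add: of_nat_diff)
  then show ?case
    using anisotropic_of_nat_eq_0D[OF assms] le by fastforce
qed auto

section \<open>Powers of polynomials\<close>

lemma coeff_mult_at_bounds:
  assumes "degree p \<le> m" "degree q \<le> n"
  shows "coeff (p * q) (m + n) = coeff p m * coeff q n"
proof -
  have "coeff p i * coeff q (m + n - i) = 0" if "i \<le> m + n" "i \<noteq> m" for i
  proof (cases "i < m")
    case True
    then show ?thesis using assms by (simp add: coeff_eq_0)
  next
    case False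
    then show ?thesis using assms that by (simp add: coeff_eq_0)
  qed
  then have "(\<Sum>i\<le>m + n. coeff p i * coeff q (m + n - i))
      = (\<Sum>i\<in>{m}. coeff p i * coeff q (m + n - i))"
    by (intro sum.mono_neutral_right) auto
  then show ?thesis by (simp add: coeff_mult)
qed

lemma coeff_power_at_bound:
  assumes "degree p \<le> m"
  shows "coeff (p ^ n) (n * m) = coeff p m ^ n"
proof (induction n)
  case (Suc n)
  have "degree (p ^ n) \<le> n * m"
    using order_trans[OF degree_power_le[of p n] mult_le_mono1[OF assms, of n]]
    by (simp add: mult.commute)
  then show ?case
    using coeff_mult_at_bounds[OF assms] Suc by simp
qed simp

text \<open>Top terms cannot cancel: at the largest degree \<open>D\<close> that occurs, the
  coefficient of the sum at \<open>2 * s * D\<close> is a sum of even powers, not all zero.\<close>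

lemma degree_le_of_sum_even_powers:
  fixes h :: "nat \<Rightarrow> 'a::idom poly"
  assumes re: "sum_squares_anisotropic TYPE('a)" and J: "finite J" and s: "s > 0"
    and deg: "degree (\<Sum>j\<in>J. h j ^ (2 * s)) \<le> 2 * s * d" and j: "j \<in> J"
  shows "degree (h j) \<le> d"
proof (rule ccontr)
  assume "\<not> degree (h j) \<le> d"
  define D where "D = Max ((\<lambda>j. degree (h j)) ` J)"
  have le: "degree (h i) \<le> D" if "i \<in> J" for i
    using J that by (simp add: D_def)
  have D: "D > d"
    using le[OF j] \<open>\<not> degree (h j) \<le> d\<close> by simp
  have "D \<in> (\<lambda>j. degree (h j)) ` J"
    unfolding D_def using J j by (intro Max_in) auto
  then obtain i where i: "i \<in> J" "degree (h i) = D"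
    by auto
  have "2 * s * d < 2 * s * D"
    using s D by simp
  then have "coeff (\<Sum>j\<in>J. h j ^ (2 * s)) (2 * s * D) = 0"
    using deg by (intro coeff_eq_0) (rule le_less_trans)
  then have "(\<Sum>j\<in>J. coeff (h j) D ^ (2 * s)) = 0"
    using le by (simp add: coeff_sum coeff_power_at_bound)
  then have "coeff (h i) D = 0"
    using sum_even_powers_eq_0D[OF re J, where u = "\<lambda>j. coeff (h j) D"] i by blast
  then have "h i = 0"
    using i(2) by auto
  then show False using i(2) D by simp
qed

lemma anisotropic_poly:
  assumes re: "sum_squares_anisotropic TYPE('a::idom)"
  shows "sum_squares_anisotropic TYPE('a poly)"
  unfolding sum_squares_anisotropic_def
proof (intro allI impI ballI)
  fix J :: "nat set" and u :: "nat \<Rightarrow> 'a poly" and j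
  assume J: "finite J" and sum0: "(\<Sum>j\<in>J. u j ^ 2) = 0" and j: "j \<in> J"
  \<comment> \<open>The degree bound with \<open>d = 0\<close> makes every \<open>u i\<close>
    constant.\<close>
  have deg: "degree (u i) \<le> 0" if "i \<in> J" for i
    using degree_le_of_sum_even_powers[OF re J, of 1 u 0 i] sum0 that by simp
  have "(\<Sum>i\<in>J. coeff (u i) 0 ^ 2) = coeff (\<Sum>j\<in>J. u j ^ 2) 0"
    by (simp add: coeff_sum coeff_0_power)
  then have "coeff (u j) 0 = 0"
    using sum_squares_anisotropicD[OF re J, of "\<lambda>i. coeff (u i) 0"] j sum0 by simp
  then show "u j = 0"
    using deg[OF j] by (metis le_zero_eq leading_coeff_0_iff)
qed

section \<open>A sum of even powers of polynomials of rapidly growing degree\<close>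

text \<open>The coefficients of \<open>P\<close> are digits in base \<open>q\<close>; the lowest one
  is divisible by \<open>q\<close> but of smaller degree, hence zero.\<close>

lemma base_expansion_unique:
  fixes q :: "'a::idom poly" and P :: "'a poly poly"
  assumes "\<And>m. degree (coeff P m) < degree q" and "poly P q = 0"
  shows "P = 0"
  using assms
proof (induction P)
  case (pCons a P)
  have a: "degree a < degree q"
    using pCons.prems(1)[of 0] by simp
  have eq: "a = - (q * poly P q)"
    using pCons.prems(2) by (simp add: eq_neg_iff_add_eq_0)
  have "a = 0"
  proof (rule ccontr)
    assume "a \<noteq> 0"
    moreover have "q dvd a" using eq by simp
    ultimately show False using a dvd_imp_degree_le by fastforce
  qed
  moreover have "q \<noteq> 0" using a by auto
  ultimately have "poly P q = 0" using eq by simp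
  moreover have "degree (coeff P m) < degree q" for m
    using pCons.prems(1)[of "Suc m"] by simp
  ultimately show ?case using pCons.IH \<open>a = 0\<close> by simp
qed simp

lemma card_ge_of_sum_even_powers:
  fixes q :: "nat \<Rightarrow> 'k::field poly" and t :: "nat \<Rightarrow> nat \<Rightarrow> 'k"
  assumes re: "sum_squares_anisotropic TYPE('k)" and s: "s > 1"
    and "\<And>k. k < r \<Longrightarrow> degree (q k) > 0"
    and "\<And>k k'. k < k' \<Longrightarrow> k' < r \<Longrightarrow> 2 * s * degree (q k) < degree (q k')"
    and "finite J"
    and "(\<Sum>j\<in>J. (\<Sum>k<r. smult (t j k) (q k)) ^ (2 * s)) = (\<Sum>k<r. q k ^ (2 * s))"
  shows "r \<le> card J"
  using assms(3-6)
proof (induction r arbitrary: J)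
  case (Suc r)
  note pos = Suc.prems(1) and grow = Suc.prems(2) and J = Suc.prems(3)
  define Q where "Q = q r"
  define w where "w j = (\<Sum>k<r. smult (t j k) (q k))" for j
  define A where "A = (\<Sum>k<r. q k ^ (2 * s))"
  \<comment> \<open>The outer variable stands for \<open>Q\<close>: \<open>poly P Q\<close> is the
    difference of the two sides, and the coefficients of \<open>P\<close> are its digits.\<close>
  define P where "P = (\<Sum>j\<in>J. [:w j, [:t j r:]:] ^ (2 * s)) - monom 1 (2 * s) - [:A:]"
  have re': "sum_squares_anisotropic TYPE('k poly)"
    by (rule anisotropic_poly[OF re])
  have Q: "degree Q > 0" using pos[of r] by (simp add: Q_def)
  have small: "degree (p ^ m) < degree Q" if "m \<le> 2 * s" "2 * s * degree p < degree Q" for p :: "'k poly" and m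
  proof -
    have "degree (p ^ m) \<le> degree p * m" by (rule degree_power_le)
    also have "\<dots> \<le> 2 * s * degree p" using that(1) by (simp add: mult.commute)
    finally show ?thesis using that(2) by simp
  qed
  have w: "2 * s * degree (w j) < degree Q" for j
  proof (cases r)
    case 0
    then show ?thesis using Q by (simp add: w_def)
  next
    case (Suc r')
    have mono: "degree (q k) \<le> degree (q r')" if "k < r" for k
    proof (cases "k = r'")
      case False
      then have "2 * s * degree (q k) < degree (q r')"
        using that grow[of k r'] Suc by simp
      moreover have "degree (q k) \<le> 2 * s * degree (q k)"
        using s by simp
      ultimately show ?thesis by linarith
    qed simp
    have "degree (w j) \<le> degree (q r')"
      unfolding w_def using mono
      by (intro degree_sum_le) (auto intro: order_trans[OF degree_smult_le])
    then have "2 * s * degree (w j) \<le> 2 * s * degree (q r')" by simp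
    also have "\<dots> < degree Q" using grow[of r' r] Suc by (simp add: Q_def)
    finally show ?thesis .
  qed
  have degA: "degree A < degree Q"
    unfolding A_def using Q grow[of _ r]
    by (intro degree_sum_less small) (auto simp: Q_def)
  have cP: "coeff P i = (\<Sum>j\<in>J. of_nat (2 * s choose i) * [:t j r:] ^ i * w j ^ (2 * s - i))
      - (if i = 2 * s then 1 else 0) - (if i = 0 then A else 0)" if "i \<le> 2 * s" for i
    unfolding P_def using that
    by (simp add: coeff_sum coeff_linear_poly_power coeff_monom coeff_pCons split: nat.split)
  have cP': "coeff P i = 0" if "i > 2 * s" for i
  proof -
    have "coeff ([:w j, [:t j r:]:] ^ (2 * s)) i = 0" for j
      using that degree_power_le[of "[:w j, [:t j r:]:]" "2 * s"]
        mult_le_mono1[of "degree [:w j, [:t j r:]:]" 1 "2 * s"]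
      by (intro coeff_eq_0) (auto split: if_splits)
    then show ?thesis
      unfolding P_def using that
      by (simp add: coeff_sum coeff_monom coeff_pCons split: nat.split)
  qed
  have "degree (coeff P i) < degree Q" for i
  proof (cases "i \<le> 2 * s")
    case True
    have "degree (of_nat (2 * s choose i) * [:t j r:] ^ i * w j ^ (2 * s - i)) < degree Q" for j
    proof -
      have "of_nat (2 * s choose i) * [:t j r:] ^ i = [:of_nat (2 * s choose i) * t j r ^ i:]"
        by (simp add: of_nat_poly poly_const_pow)
      then have "of_nat (2 * s choose i) * [:t j r:] ^ i * w j ^ (2 * s - i)
          = smult (of_nat (2 * s choose i) * t j r ^ i) (w j ^ (2 * s - i))"
        by simp
      then show ?thesis
        using small[OF _ w, of "2 * s - i" j] by (metis degree_smult_le diff_le_self le_less_trans)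
    qed
    then show ?thesis
      unfolding cP[OF True] using degA Q
      by (intro degree_diff_less degree_sum_less) auto
  next
    case False
    then show ?thesis using cP' Q by simp
  qed
  moreover have "poly P Q = 0"
    using Suc.prems(4)
    by (simp add: P_def poly_sum poly_monom w_def A_def Q_def algebra_simps)
  ultimately have "P = 0"
    by (rule base_expansion_unique)
  \<comment> \<open>As \<open>s > 1\<close>, the index \<open>2 * s - 2\<close> is neither
    \<open>2 * s\<close> nor 0, so neither \<open>monom 1 (2 * s)\<close> nor \<open>A\<close>
    contributes.\<close>
  have "(\<Sum>j\<in>J. of_nat (2 * s choose 2) * ([:t j r:] ^ (2 * s - 2) * w j ^ 2)) = 0"
    using cP[of "2 * s - 2"] s \<open>P = 0\<close> binomial_symmetric[of 2 "2 * s"]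
    by (simp add: mult.assoc)
  moreover have "of_nat (2 * s choose 2) \<noteq> (0 :: 'k poly)"
    using anisotropic_of_nat_eq_0D[OF re', of "2 * s choose 2"] s by auto
  ultimately have "(\<Sum>j\<in>J. [:t j r:] ^ (2 * s - 2) * w j ^ 2) = 0"
    by (simp add: sum_distrib_left [symmetric])
  moreover have "2 * s - 2 = (s - 1) * 2" by simp
  ultimately have "(\<Sum>j\<in>J. ([:t j r:] ^ (s - 1) * w j) ^ 2) = 0"
    by (simp only: power_mult power_mult_distrib)
  then have tw: "[:t j r:] ^ (s - 1) * w j = 0" if "j \<in> J" for j
    using sum_squares_anisotropicD[OF re' J, of "\<lambda>j. [:t j r:] ^ (s - 1) * w j"] that by blast
  \<comment> \<open>The digit at \<open>Q ^ (2 * s)\<close> provides some nonzero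
    \<open>t i r\<close>; then \<open>tw\<close> kills \<open>w i\<close>.\<close>
  have "(\<Sum>j\<in>J. [:t j r:] ^ (2 * s)) = 1"
    using cP[of "2 * s"] s \<open>P = 0\<close> by simp
  then obtain i where i: "i \<in> J" "t i r \<noteq> 0"
    using s by (metis (mono_tags, lifting) power_0_left sum.neutral zero_neq_one pCons_0_0
        mult_eq_0_iff not_one_less_zero zero_neq_numeral)
  then have wi: "w i = 0"
    using tw[of i] by simp
  have "(\<Sum>j\<in>J. w j ^ (2 * s)) = A"
    using cP[of 0] s \<open>P = 0\<close> by simp
  then have "(\<Sum>j\<in>J - {i}. w j ^ (2 * s)) = A"
    using J i wi s by (simp add: sum.remove power_0_left)
  then have "r \<le> card (J - {i})"
    using Suc.IH[of "J - {i}"] pos grow J by (simp add: w_def A_def)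
  then show ?case
    using J i by (metis Suc_le_mono card_Suc_Diff1)
qed simp

section \<open>Evaluation of multivariate polynomials\<close>

definition mpoly_eval ::
    "('k::comm_ring_1 \<Rightarrow> 'b::comm_ring_1) \<Rightarrow> ('n \<Rightarrow> 'b) \<Rightarrow> (('n \<Rightarrow>\<^sub>0 nat) \<Rightarrow>\<^sub>0 'k) \<Rightarrow> 'b" where
  "mpoly_eval c X p = (\<Sum>m\<in>Poly_Mapping.keys p.
     c (Poly_Mapping.lookup p m) * (\<Prod>i\<in>UNIV. X i ^ Poly_Mapping.lookup m i))"

lemma poly_mapping_eq_sum_single:
  "p = (\<Sum>m\<in>Poly_Mapping.keys p. Poly_Mapping.single m (Poly_Mapping.lookup p m))"
proof (rule poly_mapping_eqI)
  fix k
  have "(\<Sum>m\<in>Poly_Mapping.keys p. Poly_Mapping.lookup p m when m = k) = Poly_Mapping.lookup p k"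
    by (cases "k \<in> Poly_Mapping.keys p") (simp_all add: when_def in_keys_iff)
  then show "Poly_Mapping.lookup p k = Poly_Mapping.lookup
      (\<Sum>m\<in>Poly_Mapping.keys p. Poly_Mapping.single m (Poly_Mapping.lookup p m)) k"
    by (simp add: lookup_sum lookup_single)
qed

text \<open>If \<open>c\<close> is a ring homomorphism, so is substitution; it will map the
  \<open>n\<close>-variable ring into \<open>'k poly poly\<close>.\<close>

locale coeff_hom =
  fixes c :: "'k::comm_ring_1 \<Rightarrow> 'b::comm_ring_1" and X :: "'n \<Rightarrow> 'b"
  assumes fin: "finite (UNIV :: 'n set)"
    and c_0: "c 0 = 0" and c_1: "c 1 = 1"
    and c_add: "c (a + b) = c a + c b" and c_mult: "c (a * b) = c a * c b"
begin

lemma eval_zero: "mpoly_eval c X 0 = 0"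
  by (simp add: mpoly_eval_def)

lemma eval_add: "mpoly_eval c X (p + q) = mpoly_eval c X p + mpoly_eval c X q"
  unfolding mpoly_eval_def by (rule setsum_keys_plus_distrib) (simp_all add: c_0 c_add distrib_right)

lemma eval_sum: "mpoly_eval c X (\<Sum>i\<in>A. f i) = (\<Sum>i\<in>A. mpoly_eval c X (f i))"
  by (induction A rule: infinite_finite_induct) (simp_all add: eval_zero eval_add)

lemma eval_single:
  "mpoly_eval c X (Poly_Mapping.single m a) = c a * (\<Prod>i\<in>UNIV. X i ^ Poly_Mapping.lookup m i)"
  by (simp add: mpoly_eval_def c_0)

lemma eval_one: "mpoly_eval c X 1 = 1"
  using eval_single[of 0 1] by (simp add: c_1)

lemma eval_mult: "mpoly_eval c X (p * q) = mpoly_eval c X p * mpoly_eval c X q"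
proof -
  let ?s = "\<lambda>p m. Poly_Mapping.single m (Poly_Mapping.lookup p m)"
  have single: "mpoly_eval c X (?s p m * ?s q m')
      = mpoly_eval c X (?s p m) * mpoly_eval c X (?s q m')" for m m'
    by (simp add: mult_single eval_single c_mult lookup_add power_add prod.distrib mult_ac)
  have "mpoly_eval c X (p * q)
      = mpoly_eval c X ((\<Sum>m\<in>Poly_Mapping.keys p. ?s p m) * (\<Sum>m'\<in>Poly_Mapping.keys q. ?s q m'))"
    using poly_mapping_eq_sum_single[of p] poly_mapping_eq_sum_single[of q] by simp
  also have "\<dots> = (\<Sum>m\<in>Poly_Mapping.keys p. mpoly_eval c X (?s p m)) *
      (\<Sum>m'\<in>Poly_Mapping.keys q. mpoly_eval c X (?s q m'))"
    by (simp only: sum_product eval_sum single)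
  also have "\<dots> = mpoly_eval c X p * mpoly_eval c X q"
    by (simp only: eval_sum [symmetric] poly_mapping_eq_sum_single [symmetric])
  finally show ?thesis .
qed

lemma eval_power: "mpoly_eval c X (p ^ n) = mpoly_eval c X p ^ n"
  by (induction n) (simp_all add: eval_one eval_mult)

lemma eval_prod: "mpoly_eval c X (\<Prod>i\<in>A. f i) = (\<Prod>i\<in>A. mpoly_eval c X (f i))"
  by (induction A rule: infinite_finite_induct) (simp_all add: eval_one eval_mult)

lemma eval_of_nat: "mpoly_eval c X (of_nat n) = of_nat n"
  by (induction n) (simp_all add: eval_zero eval_one eval_add)

lemma eval_diff: "mpoly_eval c X (p - q) = mpoly_eval c X p - mpoly_eval c X q"
  using eval_add[of "p - q" q] by simp

lemma eval_var: "mpoly_eval c X (Poly_Mapping.single (Poly_Mapping.single v 1) 1) = X v"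
proof -
  have "(\<Prod>i\<in>UNIV. X i ^ Poly_Mapping.lookup (Poly_Mapping.single v 1) i)
      = (\<Prod>i\<in>UNIV. if i = v then X i else 1)"
    by (intro prod.cong) (auto simp: lookup_single)
  then show ?thesis by (simp add: eval_single c_1 fin)
qed

end

section \<open>Bivariate polynomials in the coordinates \<open>(x, xy)\<close>\<close>

text \<open>In \<open>k[y][x]\<close> the subring \<open>k[x, xy]\<close> consists of the polynomials whose coefficient of
  \<open>x\<^sup>n\<close> has degree at most \<open>n\<close> in \<open>y\<close>, and the degree in \<open>x\<close> of such an element is its
  total degree as a polynomial in \<open>x\<close> and \<open>xy\<close>.\<close>

definition in_cone :: "'a::comm_ring_1 poly poly \<Rightarrow> bool" where
  "in_cone h \<longleftrightarrow> (\<forall>n. degree (coeff h n) \<le> n)"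

lemma in_cone_add: "in_cone p \<Longrightarrow> in_cone q \<Longrightarrow> in_cone (p + q)"
  by (auto simp: in_cone_def intro: degree_add_le)

lemma in_cone_diff: "in_cone p \<Longrightarrow> in_cone q \<Longrightarrow> in_cone (p - q)"
  by (auto simp: in_cone_def intro: degree_diff_le)

lemma in_cone_mult:
  assumes "in_cone p" "in_cone q"
  shows "in_cone (p * q)"
  unfolding in_cone_def
proof
  fix n
  have "degree (coeff p i * coeff q (n - i)) \<le> n" if "i \<le> n" for i
  proof -
    have "degree (coeff p i * coeff q (n - i)) \<le> degree (coeff p i) + degree (coeff q (n - i))"
      by (rule degree_mult_le)
    also have "\<dots> \<le> i + (n - i)"
      using assms by (intro add_mono) (auto simp: in_cone_def)
    finally show ?thesis using that by simp
  qed
  then show "degree (coeff (p * q) n) \<le> n"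
    unfolding coeff_mult by (intro degree_sum_le) auto
qed

lemma in_cone_const: "in_cone [:[:a:]:]"
  by (auto simp: in_cone_def coeff_pCons split: nat.split)

lemma in_cone_zero: "in_cone 0"
  by (simp add: in_cone_def)

lemma in_cone_one: "in_cone 1"
  by (simp add: in_cone_def coeff_1)

lemma in_cone_linear: "degree p \<le> 1 \<Longrightarrow> in_cone [:[:a:], p:]"
  by (auto simp: in_cone_def coeff_pCons split: nat.split)

lemma in_cone_sum: "(\<And>i. i \<in> A \<Longrightarrow> in_cone (f i)) \<Longrightarrow> in_cone (\<Sum>i\<in>A. f i)"
  by (induction A rule: infinite_finite_induct) (auto simp: in_cone_zero in_cone_add)

lemma in_cone_prod: "(\<And>i. i \<in> A \<Longrightarrow> in_cone (f i)) \<Longrightarrow> in_cone (\<Prod>i\<in>A. f i)"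
  by (induction A rule: infinite_finite_induct) (auto simp: in_cone_one in_cone_mult)

lemma in_cone_power: "in_cone p \<Longrightarrow> in_cone (p ^ n)"
  by (induction n) (auto simp: in_cone_one in_cone_mult)

section \<open>Zeros of cone elements on a triangular array of nodes\<close>

lemma poly_map_poly_poly:
  "poly (map_poly (\<lambda>p. poly p b) h) a = poly (poly h [:a:]) b"
  by (induction h) (simp_all add: map_poly_pCons)

lemma poly_eq_0_of_nat_roots:
  fixes p :: "'a::idom poly"
  assumes "sum_squares_anisotropic TYPE('a)"
    and "finite A" and "degree p < card A" and "\<And>i. i \<in> A \<Longrightarrow> poly p (of_nat i) = 0"
  shows "p = 0"
proof -
  have "inj_on (of_nat :: nat \<Rightarrow> 'a) A"
    by (auto simp: inj_on_def anisotropic_of_nat_eq_iff[OF assms(1)])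
  then have "card (of_nat ` A :: 'a set) = card A"
    by (rule card_image)
  then show ?thesis
    using assms by (intro poly_eqI_degree[of "of_nat ` A"]) auto
qed

text \<open>If \<open>c\<^sub>n(y) x\<^sup>n\<close> is the term of lowest degree in \<open>x\<close>, then on each line \<open>y = b\<close> with
  \<open>b \<le> n\<close> the quotient of \<open>h\<close> by \<open>x\<^sup>n\<close> has degree at most \<open>d - n\<close> but more than \<open>d - n\<close> zeros, so
  \<open>c\<^sub>n\<close> has too many zeros for its degree.\<close>

lemma cone_unisolvent:
  fixes h :: "'k::idom poly poly"
  assumes re: "sum_squares_anisotropic TYPE('k)"
    and cone: "in_cone h" and deg: "degree h \<le> d"
    and zero: "\<And>a b. 1 \<le> a \<Longrightarrow> a + b \<le> d + 1 \<Longrightarrow> poly (poly h [:of_nat a:]) (of_nat b) = 0"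
  shows "h = 0"
proof (rule ccontr)
  assume "h \<noteq> 0"
  define n where "n = (LEAST n. coeff h n \<noteq> 0)"
  have "coeff h (degree h) \<noteq> 0" using \<open>h \<noteq> 0\<close> by simp
  then have n: "coeff h n \<noteq> 0" unfolding n_def by (rule LeastI)
  have below: "coeff h m = 0" if "m < n" for m
    using that not_less_Least unfolding n_def by blast
  have nd: "n \<le> d" using n deg le_degree by (meson order_trans)
  have "poly (coeff h n) (of_nat b) = 0" if b: "b \<le> n" for b
  proof -
    define H where "H = map_poly (\<lambda>p. poly p (of_nat b)) h"
    have cH: "coeff H m = poly (coeff h m) (of_nat b)" for m
      by (simp add: H_def coeff_map_poly)
    have "monom 1 n dvd H"
      by (simp add: monom_1_dvd_iff' cH below)
    then obtain G where G: "H = monom 1 n * G" by auto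
    have "G = 0"
    proof (rule ccontr)
      assume "G \<noteq> 0"
      have "degree H \<le> d"
        using deg by (intro degree_le) (simp add: cH coeff_eq_0)
      then have "degree G \<le> d - n"
        using \<open>G \<noteq> 0\<close> by (simp add: G degree_mult_eq degree_monom_eq monom_eq_0_iff)
      moreover have "poly G (of_nat a) = 0" if a: "a \<in> {1..d - n + 1}" for a
      proof -
        have "a + b \<le> d + 1" using a b nd by auto
        then have "poly H (of_nat a) = 0"
          using zero[of a b] a by (simp add: H_def poly_map_poly_poly)
        \<comment> \<open>The array starts at \<open>a = 1\<close>, so the factor
          \<open>of_nat a ^ n\<close> is nonzero and cancels.\<close>
        then show ?thesis
          using a anisotropic_of_nat_eq_0D[OF re, of a] by (auto simp: G poly_monom)
      qed
      ultimately show False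
        using poly_eq_0_of_nat_roots[OF re, of "{1..d - n + 1}" G] \<open>G \<noteq> 0\<close> by simp
    qed
    then show ?thesis using cH[of n] G by simp
  qed
  \<comment> \<open>The cone condition: degree at most \<open>n\<close> against the
    \<open>n + 1\<close> roots \<open>0, ..., n\<close>.\<close>
  moreover have "degree (coeff h n) \<le> n" using cone by (simp add: in_cone_def)
  ultimately have "coeff h n = 0"
    using poly_eq_0_of_nat_roots[OF re, of "{..n}" "coeff h n"] by simp
  with n show False by simp
qed

text \<open>This is the top form of \<open>lattice_poly d b\<close>, its coefficient at x^d; the
  choice of \<open>b\<close> sets its degree.\<close>

definition node_poly :: "nat \<Rightarrow> 'k::field poly" where
  "node_poly b = (\<Prod>i<b. [:- of_nat i, 1:])"

text \<open>In the coordinates \<open>X = x\<close>, \<open>Y = xy\<close> this is the product of the lines \<open>Y = iX\<close> for \<open>i < b\<close>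
  and \<open>X = i\<close> for \<open>1 \<le> i \<le> d - b\<close>.\<close>

definition lattice_poly :: "nat \<Rightarrow> nat \<Rightarrow> 'k::field poly poly" where
  "lattice_poly d b = (\<Prod>i<b. [:0, [:- of_nat i, 1:]:]) * (\<Prod>i\<in>{1..d - b}. [:- of_nat i, 1:])"

lemma degree_node_poly: "degree (node_poly b) = b"
  by (simp add: node_poly_def degree_prod_sum_eq)

lemma degree_lattice_poly: "b \<le> d \<Longrightarrow> degree (lattice_poly d b) = d"
  by (simp add: lattice_poly_def degree_mult_eq degree_prod_sum_eq)

lemma coeff_lattice_poly: "b \<le> d \<Longrightarrow> coeff (lattice_poly d b) d = node_poly b"
  using degree_lattice_poly[of b d, where 'a = 'a]
    lead_coeff_mult[of "\<Prod>i<b. [:0, [:- of_nat i, 1 :: 'a:]:]" "\<Prod>i\<in>{1..d - b}. [:- of_nat i, 1:]"]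
  by (simp add: lattice_poly_def node_poly_def lead_coeff_prod)

lemma in_cone_lattice_poly: "in_cone (lattice_poly d b)"
  unfolding lattice_poly_def
proof (intro in_cone_mult in_cone_prod)
  show "in_cone [:0, [:- of_nat i, 1 :: 'a:]:]" for i
    using in_cone_linear[of "[:- of_nat i, 1 :: 'a:]" 0] by simp
  show "in_cone [:- of_nat i, 1 :: 'a poly:]" for i
    using in_cone_linear[of 1 "- of_nat i :: 'a"] by (simp add: of_nat_poly)
qed

text \<open>Avoiding all the lines means \<open>b \<le> b'\<close> and \<open>d - b < a\<close>;
  with \<open>a + b' \<le> d + 1\<close> only one point of the hypotenuse is left.\<close>

lemma lattice_poly_nonzero_at_node_iff:
  assumes re: "sum_squares_anisotropic TYPE('k::field)" and "1 \<le> a" "a + b' \<le> d + 1" "b \<le> d"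
  shows "poly (poly (lattice_poly d b :: 'k poly poly) [:of_nat a:]) (of_nat b') \<noteq> 0
    \<longleftrightarrow> b' = b \<and> a = d - b + 1"
proof -
  have "poly (poly (lattice_poly d b :: 'k poly poly) [:of_nat a:]) (of_nat b')
      = (\<Prod>i<b. of_nat a * (of_nat b' - of_nat i)) * (\<Prod>i\<in>{1..d - b}. of_nat a - of_nat i)"
    by (simp add: lattice_poly_def poly_prod of_nat_poly algebra_simps)
  moreover have "(of_nat a :: 'k) \<noteq> 0"
    using anisotropic_of_nat_eq_0D[OF re, of a] assms(2) by auto
  ultimately have "poly (poly (lattice_poly d b :: 'k poly poly) [:of_nat a:]) (of_nat b') \<noteq> 0
      \<longleftrightarrow> (\<forall>i<b. b' \<noteq> i) \<and> (\<forall>i\<in>{1..d - b}. a \<noteq> i)"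
    by (auto simp: anisotropic_of_nat_eq_iff[OF re])
  also have "\<dots> \<longleftrightarrow> b \<le> b' \<and> d - b < a"
    using assms(2) by (auto simp: not_le not_less)
  also have "\<dots> \<longleftrightarrow> b' = b \<and> a = d - b + 1"
    using assms by auto
  finally show ?thesis .
qed

lemma card_ge_of_lattice_poly_even_powers:
  fixes h :: "nat \<Rightarrow> 'k::field poly poly"
  assumes re: "sum_squares_anisotropic TYPE('k)" and s: "s > 1" and J: "finite J"
    and e: "\<And>k. k < r \<Longrightarrow> 0 < e k" "\<And>k. k < r \<Longrightarrow> e k \<le> d"
    and grow: "\<And>k k'. k < k' \<Longrightarrow> k' < r \<Longrightarrow> 2 * s * e k < e k'"
    and cone: "\<And>j. j \<in> J \<Longrightarrow> in_cone (h j)"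
    and eq: "(\<Sum>j\<in>J. h j ^ (2 * s)) = (\<Sum>k<r. lattice_poly d (e k) ^ (2 * s))"
  shows "r \<le> card J"
proof -
  let ?g = "\<lambda>k. lattice_poly d (e k) :: 'k poly poly"
  let ?ev = "\<lambda>a b h. poly (poly h [:of_nat a:]) (of_nat b) :: 'k"
  have re': "sum_squares_anisotropic TYPE('k poly)"
    by (rule anisotropic_poly[OF re])
  have e_inj: "k = k'" if "k < r" "k' < r" "e k = e k'" for k k'
  proof -
    have lt: "e i < e i'" if "i < i'" "i' < r" for i i'
    proof -
      have "e i \<le> 2 * s * e i" using s by simp
      then show ?thesis using grow[OF that] by linarith
    qed
    show ?thesis using lt[of k k'] lt[of k' k] that by (metis less_irrefl linorder_neqE_nat)
  qed
  have "degree (?g k ^ (2 * s)) \<le> 2 * s * d" if "k < r" for k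
    using degree_power_le[of "?g k" "2 * s"] degree_lattice_poly[of "e k" d, where 'a = 'k] e that
    by (simp add: mult.commute)
  then have "degree (\<Sum>j\<in>J. h j ^ (2 * s)) \<le> 2 * s * d"
    unfolding eq by (intro degree_sum_le) auto
  then have deg: "degree (h j) \<le> d" if "j \<in> J" for j
    using degree_le_of_sum_even_powers[OF re' J, where h = h and s = s and d = d and j = j] s that
    by simp
  \<comment> \<open>Lagrange coefficients: at the node omitted by \<open>?g k\<close>, the other
    \<open>?g k'\<close> vanish.\<close>
  define t where "t j k = ?ev (d - e k + 1) (e k) (h j) / ?ev (d - e k + 1) (e k) (?g k)" for j k
  have ev_g: "?ev a b (?g k) \<noteq> 0 \<longleftrightarrow> b = e k \<and> a = d - e k + 1"
    if "1 \<le> a" "a + b \<le> d + 1" "k < r" for a b k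
    using lattice_poly_nonzero_at_node_iff[OF re, of a b d "e k"] e that by blast
  have h_eq: "h j = (\<Sum>k<r. [:[:t j k:]:] * ?g k)" if j: "j \<in> J" for j
  proof -
    let ?D = "h j - (\<Sum>k<r. [:[:t j k:]:] * ?g k)"
    have "?D = 0"
    proof (rule cone_unisolvent[OF re])
      show "in_cone ?D"
        using cone[OF j] by (intro in_cone_diff in_cone_sum in_cone_mult in_cone_const in_cone_lattice_poly)
      have "degree ([:[:t j k:]:] * ?g k) \<le> d" if "k < r" for k
        using degree_mult_le[of "[:[:t j k:]:]" "?g k"] degree_lattice_poly[of "e k" d, where 'a = 'k] e that
        by simp
      then show "degree ?D \<le> d"
        using deg[OF j] by (intro degree_diff_le degree_sum_le) auto
    next
      fix a b :: nat
      assume ab: "1 \<le> a" "a + b \<le> d + 1"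
      have evD: "?ev a b ?D = ?ev a b (h j) - (\<Sum>k<r. t j k * ?ev a b (?g k))"
        by (simp add: poly_sum)
      show "?ev a b ?D = 0"
      proof (cases "\<exists>k<r. b = e k \<and> a = d - e k + 1")
        case True
        then obtain k where k: "k < r" "b = e k" "a = d - e k + 1" by blast
        have "(\<Sum>k'<r. t j k' * ?ev a b (?g k')) = (\<Sum>k'\<in>{k}. t j k' * ?ev a b (?g k'))"
        proof (rule sum.mono_neutral_right)
          show "\<forall>k'\<in>{..<r} - {k}. t j k' * ?ev a b (?g k') = 0"
            using ev_g[OF ab] k e_inj by fastforce
        qed (use k in auto)
        moreover have "?ev a b (?g k) \<noteq> 0" using ev_g[OF ab] k by blast
        ultimately show ?thesis unfolding evD using k by (simp add: t_def)
      next
        case False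
        then have g0: "?ev a b (?g k) = 0" if "k < r" for k
          using ev_g[OF ab that] that by blast
        have "(\<Sum>j\<in>J. ?ev a b (h j) ^ (2 * s)) = ?ev a b (\<Sum>j\<in>J. h j ^ (2 * s))"
          by (simp add: poly_sum poly_power)
        also have "\<dots> = 0"
          unfolding eq using g0 s by (simp add: poly_sum poly_power power_0_left)
        finally have "?ev a b (h j) = 0"
          using sum_even_powers_eq_0D[OF re J, where u = "\<lambda>j. ?ev a b (h j)"] j by blast
        then show ?thesis unfolding evD using g0 by simp
      qed
    qed
    then show ?thesis by simp
  qed
  have coeff_h: "coeff (h j) d = (\<Sum>k<r. smult (t j k) (node_poly (e k)))" if "j \<in> J" for j
    using e by (simp add: h_eq[OF that] coeff_sum coeff_lattice_poly)
  \<comment> \<open>Comparing coefficients at x^(2sd) passes to top forms, whose degrees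
    \<open>e k\<close> grow fast.\<close>
  have "(\<Sum>j\<in>J. coeff (h j) d ^ (2 * s)) = coeff (\<Sum>j\<in>J. h j ^ (2 * s)) (2 * s * d)"
    using deg by (simp add: coeff_sum coeff_power_at_bound)
  also have "\<dots> = (\<Sum>k<r. coeff (?g k) d ^ (2 * s))"
    unfolding eq using e by (simp add: coeff_sum coeff_power_at_bound degree_lattice_poly)
  finally have "(\<Sum>j\<in>J. (\<Sum>k<r. smult (t j k) (node_poly (e k))) ^ (2 * s))
      = (\<Sum>k<r. node_poly (e k) ^ (2 * s))"
    using e by (simp add: coeff_h coeff_lattice_poly)
  then show ?thesis
    using e grow by (intro card_ge_of_sum_even_powers[OF re s _ _ J, of r "\<lambda>k. node_poly (e k)" t])
      (auto simp: degree_node_poly)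
qed

section \<open>Reduction from \<open>n\<close> variables to two\<close>

theorem mainTheorem2:
  fixes n s :: nat
  assumes "CARD('n) = n" and "n > 1" and "s > 1"
    and "formally_real TYPE('k::field)"
  shows "pythagoras_number TYPE(('n \<Rightarrow>\<^sub>0 nat) \<Rightarrow>\<^sub>0 'k) (2 * s) = \<infinity>"
proof -
  have re: "sum_squares_anisotropic TYPE('k)"
    using assms(4) by (rule formally_real_imp_anisotropic)
  have fin: "finite (UNIV :: 'n set)"
    using assms(1,2) card_ge_0_finite by force
  obtain v1 v2 :: 'n where v: "v1 \<noteq> v2"
    using assms(1,2) card_le_Suc0_iff_eq[OF fin] by fastforce
  define c where "c a = [:[:a:]:]" for a :: 'k
  \<comment> \<open>\<open>v2\<close> goes to xy and all other variables to x, so every image lies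
    in the cone.\<close>
  define X where "X i = (if i = v2 then [:0, [:0, 1 :: 'k:]:] else [:0, 1:])" for i :: 'n
  interpret coeff_hom c X
    by unfold_locales (simp_all add: fin c_def one_pCons)
  have cone: "in_cone (mpoly_eval c X p)" for p
  proof -
    have "in_cone (X i)" for i
      using in_cone_linear[of "[:0, 1 :: 'k:]" 0] in_cone_linear[of "1 :: 'k poly" 0] by (simp add: X_def)
    then show ?thesis
      unfolding mpoly_eval_def c_def
      by (intro in_cone_sum in_cone_mult in_cone_const in_cone_prod in_cone_power)
  qed
  let ?x = "\<lambda>v. Poly_Mapping.single (Poly_Mapping.single v 1) 1 :: ('n \<Rightarrow>\<^sub>0 nat) \<Rightarrow>\<^sub>0 'k"
  define G where "G d b = (\<Prod>i<b. ?x v2 - of_nat i * ?x v1) * (\<Prod>i\<in>{1..d - b}. ?x v1 - of_nat i)" for d b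
  have eval_G: "mpoly_eval c X (G d b) = lattice_poly d b" for d b
  proof -
    have "mpoly_eval c X (?x v2 - of_nat i * ?x v1) = [:0, [:- of_nat i, 1:]:]" for i
      using v by (simp add: eval_diff eval_mult eval_of_nat eval_var X_def of_nat_poly del: One_nat_def)
    moreover have "mpoly_eval c X (?x v1 - of_nat i) = [:- of_nat i, 1:]" for i
      using v by (simp add: eval_diff eval_of_nat eval_var X_def of_nat_poly del: One_nat_def)
    ultimately show ?thesis
      by (simp add: G_def eval_mult eval_prod lattice_poly_def)
  qed
  have "\<not> pythagoras_bound TYPE(('n \<Rightarrow>\<^sub>0 nat) \<Rightarrow>\<^sub>0 'k) (2 * s) l" for l
  proof
    assume bound: "pythagoras_bound TYPE(('n \<Rightarrow>\<^sub>0 nat) \<Rightarrow>\<^sub>0 'k) (2 * s) l"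
    \<comment> \<open>Ratio \<open>2 * s + 1\<close> gives growth by more than \<open>2 * s\<close>;
      \<open>e l\<close> is the largest exponent used and serves as \<open>d\<close>. The sum
      \<open>f\<close> has \<open>l + 1\<close> powers, one more than the bound.\<close>
    define e where "e k = (2 * s + 1) ^ k" for k :: nat
    define f where "f = (\<Sum>k<Suc l. G (e l) (e k) ^ (2 * s))"
    have "f = sum_list (map (\<lambda>y. y ^ (2 * s)) (map (\<lambda>k. G (e l) (e k)) [0..<Suc l]))"
      unfolding f_def by (simp only: map_map o_def interv_sum_list_conv_sum_set_nat set_upt atLeast0LessThan)
    then have "sum_of_mth_powers (2 * s) f"
      unfolding sum_of_mth_powers_def by blast
    then obtain ys where ys: "length ys \<le> l" "f = sum_list (map (\<lambda>y. y ^ (2 * s)) ys)"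
      using bound unfolding pythagoras_bound_def sum_of_at_most_mth_powers_def by blast
    have f: "f = (\<Sum>j<length ys. ys ! j ^ (2 * s))"
      by (simp add: ys(2) sum_list_sum_nth atLeast0LessThan)
    have grow: "2 * s * e k < e k'" if "k < k'" for k k'
    proof -
      have "2 * s * e k < (2 * s + 1) * e k" by (simp add: e_def)
      also have "\<dots> = e (Suc k)" by (simp add: e_def)
      also have "\<dots> \<le> e k'" unfolding e_def using that by (intro power_increasing) auto
      finally show ?thesis .
    qed
    have "Suc l \<le> card {..<length ys}"
    proof (rule card_ge_of_lattice_poly_even_powers[OF re assms(3)])
      show "0 < e k" for k by (simp add: e_def)
      show "e k \<le> e l" if "k < Suc l" for k
        unfolding e_def using that by (intro power_increasing) auto
      show "2 * s * e k < e k'" if "k < k'" for k k' by (rule grow[OF that])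
      show "in_cone (mpoly_eval c X (ys ! j))" for j by (rule cone)
      have "(\<Sum>j<length ys. mpoly_eval c X (ys ! j) ^ (2 * s)) = mpoly_eval c X f"
        by (simp only: f eval_sum eval_power)
      also have "\<dots> = (\<Sum>k<Suc l. lattice_poly (e l) (e k) ^ (2 * s))"
        by (simp only: f_def eval_sum eval_power eval_G)
      finally show "(\<Sum>j<length ys. mpoly_eval c X (ys ! j) ^ (2 * s))
          = (\<Sum>k<Suc l. lattice_poly (e l) (e k) ^ (2 * s))" .
    qed simp
    then show False using ys(1) by simp
  qed
  then show ?thesis by (simp add: pythagoras_number_def)
qed

end
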